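(* Let $a,b,c$ be integers such that the quadratic form $\frac12(an_1^2+2bn_1n_2+cn_2^2)$ is positive definite, let $\bm\alpha=(\alpha_1,\alpha_2)\in\mathbb{Q}^2$, and let $\Delta:=ac-b^2>0$. Then for $\tau\in\mathbb{H}$, $q=e^{2\pi i\tau}$, $$\sum_{\bm n \in \mathbb{Z}^2+\bm\alpha}\mathrm{sgn}(n_1)\,\mathrm{sgn}(n_2)\,q^{\frac12\left(an_1^2+2b n_1n_2+c n_2^2\right)} - \frac{2}{\pi}\, \delta_{\bm\alpha \in \mathbb{Z}^2} \arctan\left(\frac{b}{\sqrt{\Delta}}\right)$$ $$=\sqrt{\Delta} \int_{\tau}^{\tau+i\infty} \int_{\tau}^{w_1} \frac{\Theta_1(\bm w)+ \Theta_2(\bm w)}{ \sqrt{i (w_1-\tau)} \sqrt{i (w_2-\tau)}}\,d w_2\, d w_1 - \frac{2}{\pi} \arctan\left(\frac{b}{\sqrt{\Delta}}\right) \Theta(\tau).$$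
   Context: $\mathbb{H}$ is the upper half-plane. $\mathrm{sgn}(x)=x/|x|$ for $x\neq0$ and $\mathrm{sgn}(0)=0$. $\delta_C=1$ if condition $C$ holds and $0$ otherwise. Square roots are principal, and the integrals are along the vertical path from $\tau$ to $i\infty$ ($w_2$ running along the part of it from $\tau$ to $w_1$). With $\bm w=(w_1,w_2)$, $$\Theta_1(\bm w) :=\sum_{\bm n \in \mathbb{Z}^2+\bm\alpha} n_1 \left( n_2+\frac{b}{c}n_1\right) e^{\pi i \frac{\Delta}{c} n_1^2 w_1+ \pi i c \left(n_2+\frac{b}{c}n_1\right)^2 w_2},$$ $$\Theta_2(\bm w) :=\sum_{\bm n \in \mathbb{Z}^2+\bm\alpha } n_2 \left( n_1+\frac{b}{a}n_2 \right) e^{\pi i \frac{\Delta}{a} n_2^2 w_1 + \pi i a \left( n_1+\frac{b}{a} n_2 \right)^2 w_2},$$ $$\Theta(\tau):=\sum_{\bm n \in \mathbb{Z}^2+\bm\alpha } q^{\frac{1}{2}\left(an_1^2+2b n_1n_2+c n_2^2\right)}.$$ *)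

theory Defs
  imports "HOL-Complex_Analysis.Contour_Integration"
begin

definition shifted_lattice :: "real \<times> real \<Rightarrow> (real \<times> real) set" where
  "shifted_lattice \<alpha> = {(of_int m\<^sub>1 + fst \<alpha>, of_int m\<^sub>2 + snd \<alpha>) | m\<^sub>1 m\<^sub>2 :: int. True}"

definition quad_form :: "int \<Rightarrow> int \<Rightarrow> int \<Rightarrow> real \<times> real \<Rightarrow> real" where
  "quad_form a b c = (\<lambda>(x, y). (a * x\<^sup>2 + 2 * b * x * y + c * y\<^sup>2) / 2)"

definition pos_def_form :: "int \<Rightarrow> int \<Rightarrow> int \<Rightarrow> bool" where
  "pos_def_form a b c \<longleftrightarrow> (\<forall>v. v \<noteq> 0 \<longrightarrow> quad_form a b c v > 0)"

definition Discr :: "int \<Rightarrow> int \<Rightarrow> int \<Rightarrow> int" where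
  "Discr a b c = a * c - b\<^sup>2"

text \<open>The power \<open>q\<^sup>r\<close> for \<open>q = exp (2\<pi>i\<tau>)\<close> and real \<open>r\<close>. It depends on the choice of \<open>\<tau>\<close>,
  not only on \<open>q\<close>, so it is not \<open>q powr r\<close>.\<close>

definition q_power :: "complex \<Rightarrow> real \<Rightarrow> complex" where
  "q_power \<tau> r = exp (2 * pi * \<i> * \<tau> * r)"

definition false_theta_term :: "int \<Rightarrow> int \<Rightarrow> int \<Rightarrow> complex \<Rightarrow> real \<times> real \<Rightarrow> complex" where
  "false_theta_term a b c \<tau> n =
     complex_of_real (sgn (fst n) * sgn (snd n)) * q_power \<tau> (quad_form a b c n)"

definition Theta_term :: "int \<Rightarrow> int \<Rightarrow> int \<Rightarrow> complex \<Rightarrow> real \<times> real \<Rightarrow> complex" where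
  "Theta_term a b c \<tau> n = q_power \<tau> (quad_form a b c n)"

definition Theta1_term ::
    "int \<Rightarrow> int \<Rightarrow> int \<Rightarrow> complex \<times> complex \<Rightarrow> real \<times> real \<Rightarrow> complex" where
  "Theta1_term a b c = (\<lambda>(w\<^sub>1, w\<^sub>2) (n\<^sub>1, n\<^sub>2).
     complex_of_real (n\<^sub>1 * (n\<^sub>2 + b / c * n\<^sub>1)) *
     exp (pi * \<i> * complex_of_real (Discr a b c / c * n\<^sub>1\<^sup>2) * w\<^sub>1 +
          pi * \<i> * complex_of_real (c * (n\<^sub>2 + b / c * n\<^sub>1)\<^sup>2) * w\<^sub>2))"

definition Theta2_term ::
    "int \<Rightarrow> int \<Rightarrow> int \<Rightarrow> complex \<times> complex \<Rightarrow> real \<times> real \<Rightarrow> complex" where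
  "Theta2_term a b c = (\<lambda>(w\<^sub>1, w\<^sub>2) (n\<^sub>1, n\<^sub>2).
     complex_of_real (n\<^sub>2 * (n\<^sub>1 + b / a * n\<^sub>2)) *
     exp (pi * \<i> * complex_of_real (Discr a b c / a * n\<^sub>2\<^sup>2) * w\<^sub>1 +
          pi * \<i> * complex_of_real (a * (n\<^sub>1 + b / a * n\<^sub>2)\<^sup>2) * w\<^sub>2))"

definition false_theta :: "int \<Rightarrow> int \<Rightarrow> int \<Rightarrow> real \<times> real \<Rightarrow> complex \<Rightarrow> complex" where
  "false_theta a b c \<alpha> \<tau> = (\<Sum>\<^sub>\<infinity>n\<in>shifted_lattice \<alpha>. false_theta_term a b c \<tau> n)"

definition Theta :: "int \<Rightarrow> int \<Rightarrow> int \<Rightarrow> real \<times> real \<Rightarrow> complex \<Rightarrow> complex" where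
  "Theta a b c \<alpha> \<tau> = (\<Sum>\<^sub>\<infinity>n\<in>shifted_lattice \<alpha>. Theta_term a b c \<tau> n)"

definition Theta1 :: "int \<Rightarrow> int \<Rightarrow> int \<Rightarrow> real \<times> real \<Rightarrow> complex \<times> complex \<Rightarrow> complex" where
  "Theta1 a b c \<alpha> w = (\<Sum>\<^sub>\<infinity>n\<in>shifted_lattice \<alpha>. Theta1_term a b c w n)"

definition Theta2 :: "int \<Rightarrow> int \<Rightarrow> int \<Rightarrow> real \<times> real \<Rightarrow> complex \<times> complex \<Rightarrow> complex" where
  "Theta2 a b c \<alpha> w = (\<Sum>\<^sub>\<infinity>n\<in>shifted_lattice \<alpha>. Theta2_term a b c w n)"

text \<open>The integral of \<open>f\<close> from \<open>\<tau>\<close> to \<open>\<tau> + i\<infinity>\<close>, along \<open>w = \<tau> + it\<close>, \<open>dw = i dt\<close>. Like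
  \<^const>\<open>contour_integral\<close> on bounded paths it is a Henstock--Kurzweil integral, so the
  integrable singularities at the starting point \<open>\<tau>\<close> are covered.\<close>

definition vertically_integrable :: "(complex \<Rightarrow> complex) \<Rightarrow> complex \<Rightarrow> bool" where
  "vertically_integrable f \<tau> \<longleftrightarrow> (\<lambda>t::real. f (\<tau> + \<i> * t) * \<i>) integrable_on {0..}"

definition vertical_integral :: "complex \<Rightarrow> (complex \<Rightarrow> complex) \<Rightarrow> complex" where
  "vertical_integral \<tau> f = integral {0..} (\<lambda>t::real. f (\<tau> + \<i> * t) * \<i>)"

definition theta_integrand ::
    "int \<Rightarrow> int \<Rightarrow> int \<Rightarrow> real \<times> real \<Rightarrow> complex \<Rightarrow> complex \<Rightarrow> complex \<Rightarrow> complex" where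
  "theta_integrand a b c \<alpha> \<tau> w\<^sub>1 w\<^sub>2 =
     (Theta1 a b c \<alpha> (w\<^sub>1, w\<^sub>2) + Theta2 a b c \<alpha> (w\<^sub>1, w\<^sub>2)) /
     (csqrt (\<i> * (w\<^sub>1 - \<tau>)) * csqrt (\<i> * (w\<^sub>2 - \<tau>)))"

end

theory Submission imports Defs
begin

text \<open>
  Along \<open>w\<^sub>1 = \<tau> + it\<close> and \<open>w\<^sub>2 = \<tau> + itx\<close> the two square roots combine to \<open>- t \<surd>x\<close>, so each lattice
  point contributes \<open>q\<close> to the power of the quadratic form times
  \<open>\<integral>\<integral> p r exp (- \<pi> (p\<^sup>2 t + r\<^sup>2 t x)) / \<surd>x dx dt\<close>, where \<open>(p\<^sup>2 + r\<^sup>2) / 2\<close> is the value of the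
  form after completing the square. Integrating first over \<open>t\<close> and then over \<open>x\<close> gives
  \<open>(2 / \<pi>) arctan (r / p)\<close>, and the convention \<open>r / 0 = 0\<close> covers the points where the
  coefficient vanishes. For nonzero coordinates the two arctangents belonging to \<open>\<Theta>\<^sub>1\<close> and \<open>\<Theta>\<^sub>2\<close> add up
  to \<open>arctan (b / \<surd>\<Delta>) \<plusminus> \<pi> / 2\<close>, the sign being that of \<open>n\<^sub>1 n\<^sub>2\<close>; if exactly one coordinate
  is zero the sum is \<open>arctan (b / \<surd>\<Delta>)\<close>, and the origin accounts for the correction term.
  Since \<open>arctan\<close> is bounded, sums and integrals may be exchanged.
\<close>

section \<open>Interchange of countable sums with Lebesgue integrals\<close>

text \<open>An enumeration of an infinite \<open>I\<close> reduces this to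
  \<open>integrable_suminf\<close> and \<open>sums_integral\<close> for series over the naturals.
  Summability of the norms, pointwise and after integration, makes every sum independent of the
  enumeration.\<close>

lemma has_sum_lebesgue_integral:
  fixes f :: "'i \<Rightarrow> 'a \<Rightarrow> 'b::{banach, second_countable_topology}"
  assumes "countable I"
    and int: "\<And>i. i \<in> I \<Longrightarrow> integrable M (f i)"
    and sm: "\<And>x. x \<in> space M \<Longrightarrow> (\<lambda>i. norm (f i x)) summable_on I"
    and smi: "(\<lambda>i. \<integral>x. norm (f i x) \<partial>M) summable_on I"
  shows "integrable M (\<lambda>x. \<Sum>\<^sub>\<infinity>i\<in>I. f i x)"
    and "((\<lambda>i. \<integral>x. f i x \<partial>M) has_sum (\<integral>x. (\<Sum>\<^sub>\<infinity>i\<in>I. f i x) \<partial>M)) I"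
proof -
  have "integrable M (\<lambda>x. \<Sum>\<^sub>\<infinity>i\<in>I. f i x) \<and>
    ((\<lambda>i. \<integral>x. f i x \<partial>M) has_sum (\<integral>x. (\<Sum>\<^sub>\<infinity>i\<in>I. f i x) \<partial>M)) I"
  proof (cases "finite I")
    case True
    then show ?thesis using int by (auto simp: integral_sum intro!: has_sum_finiteI)
  next
    case False
    define e where "e = from_nat_into I"
    have e: "bij_betw e UNIV I" unfolding e_def
      using \<open>countable I\<close> False by (rule bij_betw_from_nat_into)
    have eI: "e n \<in> I" for n using e by (auto simp: bij_betw_def)
    have s1: "summable (\<lambda>n. norm (f (e n) x))" if "x \<in> space M" for x
      using sm[OF that] by (subst (asm) summable_on_reindex_bij_betw[OF e, symmetric])
        (rule summable_on_imp_summable)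
    have s2: "summable (\<lambda>n. \<integral>x. norm (f (e n) x) \<partial>M)"
      using smi by (subst (asm) summable_on_reindex_bij_betw[OF e, symmetric])
        (rule summable_on_imp_summable)
    have eq: "(\<Sum>\<^sub>\<infinity>i\<in>I. f i x) = (\<Sum>n. f (e n) x)" if "x \<in> space M" for x
    proof -
      have "((\<lambda>n. f (e n) x) has_sum (\<Sum>n. f (e n) x)) UNIV"
        by (rule norm_summable_imp_has_sum[OF s1[OF that] summable_sums[OF summable_norm_cancel[OF s1[OF that]]]])
      then have "(\<Sum>\<^sub>\<infinity>n. f (e n) x) = (\<Sum>n. f (e n) x)"
        by (rule infsumI)
      then show ?thesis
        unfolding infsum_reindex_bij_betw[OF e, of "\<lambda>i. f i x"] .
    qed
    have ae: "AE x in M. summable (\<lambda>n. norm (f (e n) x))" using s1 by auto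
    have 1: "integrable M (\<lambda>x. \<Sum>n. f (e n) x)"
      by (rule integrable_suminf[OF int[OF eI] ae s2])
    have 2: "(\<lambda>n. \<integral>x. f (e n) x \<partial>M) sums (\<integral>x. (\<Sum>n. f (e n) x) \<partial>M)"
      by (rule sums_integral[OF int[OF eI] ae s2])
    \<comment> \<open>Absolute convergence upgrades the ordered \<open>sums\<close> to the unordered
      \<open>has_sum\<close>.\<close>
    have 3: "summable (\<lambda>n. norm (\<integral>x. f (e n) x \<partial>M))"
      by (rule summable_comparison_test[OF _ s2]) (auto intro!: exI[of _ 0] integral_norm_bound)
    have "((\<lambda>n. \<integral>x. f (e n) x \<partial>M) has_sum (\<integral>x. (\<Sum>n. f (e n) x) \<partial>M)) UNIV"
      by (rule norm_summable_imp_has_sum[OF 3 2])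
    then have "((\<lambda>i. \<integral>x. f i x \<partial>M) has_sum (\<integral>x. (\<Sum>n. f (e n) x) \<partial>M)) I"
      by (subst (asm) has_sum_reindex_bij_betw[OF e])
    moreover have "(\<integral>x. (\<Sum>\<^sub>\<infinity>i\<in>I. f i x) \<partial>M) = (\<integral>x. (\<Sum>n. f (e n) x) \<partial>M)"
      by (rule Bochner_Integration.integral_cong[OF refl eq])
    moreover have "integrable M (\<lambda>x. \<Sum>\<^sub>\<infinity>i\<in>I. f i x)"
      by (subst Bochner_Integration.integrable_cong[OF refl eq]) (use 1 in auto)
    ultimately show ?thesis by simp
  qed
  then show "integrable M (\<lambda>x. \<Sum>\<^sub>\<infinity>i\<in>I. f i x)"
    and "((\<lambda>i. \<integral>x. f i x \<partial>M) has_sum (\<integral>x. (\<Sum>\<^sub>\<infinity>i\<in>I. f i x) \<partial>M)) I"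
    by auto
qed

section \<open>The addition identity for the two arctangents\<close>

text \<open>\<open>cos \<phi>\<close> is a multiple of \<open>1 - X * Y + (X + Y) * B\<close>, which
  vanishes because \<open>D\<^sup>2 = a * c - b\<^sup>2\<close>. So \<phi> is an odd multiple of
  \<open>pi / 2\<close>, and the range of \<open>arctan\<close> together with the sign of
  \<open>X - B\<close> singles out which one.\<close>

lemma arctan_sum_eq:
  fixes a b c D x y :: real
  assumes D: "D > 0" "D\<^sup>2 = a * c - b\<^sup>2" and "c > 0" and xy: "x \<noteq> 0" "y \<noteq> 0"
  shows "arctan ((c * y + b * x) / (D * x)) + arctan ((a * x + b * y) / (D * y)) - arctan (b / D)
    = pi / 2 * (sgn x * sgn y)"
proof -
  define X Y B where "X = (c * y + b * x) / (D * x)" and "Y = (a * x + b * y) / (D * y)" and "B = b / D"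
  define \<phi> where "\<phi> = arctan X + arctan Y - arctan B"
  have "(1 - X * Y + (X + Y) * B) * (D\<^sup>2 * (x * y)) =
      D\<^sup>2 * (x * y) - (c * y + b * x) * (a * x + b * y) + b * ((c * y + b * x) * y + (a * x + b * y) * x)"
    using D(1) xy unfolding X_def Y_def B_def by (simp add: field_simps power2_eq_square)
  also have "\<dots> = 0" unfolding D(2) by (simp add: algebra_simps power2_eq_square)
  finally have rel: "1 - X * Y + (X + Y) * B = 0" using D(1) xy by simp
  have "cos \<phi> = (1 - X * Y + (X + Y) * B) / (sqrt (1 + X\<^sup>2) * sqrt (1 + Y\<^sup>2) * sqrt (1 + B\<^sup>2))"
    unfolding \<phi>_def cos_diff cos_add sin_add cos_arctan sin_arctan
    by (simp add: add_divide_distrib diff_divide_distrib algebra_simps)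
  then have cos0: "cos \<phi> = 0" using rel by simp
  have XB: "X - B = (c / D) * (y / x)"
    using D(1) xy unfolding X_def B_def by (simp add: field_simps)
  note bounds = arctan_lbound[of X] arctan_ubound[of X] arctan_lbound[of Y] arctan_ubound[of Y]
    arctan_lbound[of B] arctan_ubound[of B]
  have "\<phi> = pi / 2 * (sgn x * sgn y)"
  proof (cases "x * y > 0")
    case True
    then have "y / x > 0" by (auto simp: zero_less_mult_iff zero_less_divide_iff)
    then have "X - B > 0" unfolding XB using D(1) \<open>c > 0\<close> by (intro mult_pos_pos) auto
    \<comment> \<open>This puts \<phi> strictly between \<open>- pi / 2\<close> and
      \<open>3 * pi / 2\<close>, so \<open>\<phi> - pi / 2\<close> lies strictly between
      \<open>- pi\<close> and \<open>pi\<close>, where the sine vanishes only at 0.\<close>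
    then have *: "arctan B < arctan X" by (simp add: arctan_less_iff)
    have "\<phi> - pi / 2 = 0"
    proof (rule sin_eq_0_pi)
      show "sin (\<phi> - pi / 2) = 0" using cos0 by (simp add: sin_diff)
    qed (use bounds * in \<open>unfold \<phi>_def, linarith+\<close>)
    moreover have "sgn x * sgn y = 1" using True by (metis sgn_mult sgn_pos)
    ultimately show ?thesis by simp
  next
    case False
    then have neg: "x * y < 0" using xy by (simp add: less_le)
    then have "y / x < 0" by (auto simp: mult_less_0_iff divide_less_0_iff)
    then have "X - B < 0" unfolding XB using D(1) \<open>c > 0\<close> by (intro mult_pos_neg) auto
    then have *: "arctan X < arctan B" by (simp add: arctan_less_iff)
    have "\<phi> + pi / 2 = 0"
    proof (rule sin_eq_0_pi)
      show "sin (\<phi> + pi / 2) = 0" using cos0 by (simp add: sin_add)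
    qed (use bounds * in \<open>unfold \<phi>_def, linarith+\<close>)
    moreover have "sgn x * sgn y = -1" using neg by (metis sgn_mult sgn_neg)
    ultimately show ?thesis by simp
  qed
  then show ?thesis by (simp add: \<phi>_def X_def Y_def B_def)
qed

section \<open>Gaussian series over the integers\<close>

lemma summable_on_int_geometric:
  fixes q :: real assumes "0 \<le> q" "q < 1"
  shows "(\<lambda>k::int. q ^ nat \<bar>k\<bar>) summable_on UNIV"
proof -
  have g: "(\<lambda>n::nat. q ^ n) summable_on UNIV"
    using assms by (intro norm_summable_imp_summable_on) (simp add: summable_geometric)
  have "(\<lambda>k::int. q ^ nat \<bar>k\<bar>) summable_on (range int)"
    by (subst summable_on_reindex) (use g in \<open>simp_all add: o_def\<close>)
  moreover have "(\<lambda>k::int. q ^ nat \<bar>k\<bar>) summable_on (range (\<lambda>n. - int n))"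
    by (subst summable_on_reindex) (use g in \<open>simp_all add: o_def inj_on_def\<close>)
  ultimately have "(\<lambda>k::int. q ^ nat \<bar>k\<bar>) summable_on (range int \<union> range (\<lambda>n. - int n))"
    by (rule summable_on_union)
  moreover have "k \<in> range int \<union> range (\<lambda>n. - int n)" for k :: int
    by (cases k rule: int_cases2) auto
  then have "range int \<union> range (\<lambda>n. - int n) = UNIV" by blast
  ultimately show ?thesis by simp
qed

text \<open>With \<open>u = \<bar>of_int k + \<beta>\<bar>\<close>, the square of \<open>u\<close>
  lies above its tangent \<open>2 * u - 1\<close> at 1. This gives a geometric majorant of ratio
  \<open>exp (- (2 * \<delta>))\<close>; the shift \<beta> only enters the constant.\<close>

lemma summable_on_gaussian:
  fixes \<delta> \<beta> :: real assumes "\<delta> > 0"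
  shows "(\<lambda>k::int. exp (- (\<delta> * (of_int k + \<beta>)\<^sup>2))) summable_on UNIV"
proof (rule summable_on_comparison_test)
  let ?C = "exp (\<delta> * (1 + 2 * \<bar>\<beta>\<bar>))" and ?q = "exp (- (2 * \<delta>))"
  show "(\<lambda>k::int. ?C * ?q ^ nat \<bar>k\<bar>) summable_on UNIV"
    using assms by (intro summable_on_cmult_right summable_on_int_geometric) auto
  fix k :: int
  have "0 \<le> (\<bar>of_int k + \<beta>\<bar> - 1)\<^sup>2" by simp
  then have "2 * \<bar>of_int k + \<beta>\<bar> - 1 \<le> (of_int k + \<beta>)\<^sup>2"
    unfolding power2_diff by simp
  moreover have "\<bar>of_int k :: real\<bar> \<le> \<bar>of_int k + \<beta>\<bar> + \<bar>\<beta>\<bar>" by linarith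
  moreover define u where "u = \<bar>of_int k + \<beta>\<bar>"
  ultimately have *: "2 * \<bar>of_int k :: real\<bar> - (1 + 2 * \<bar>\<beta>\<bar>) \<le> (of_int k + \<beta>)\<^sup>2"
    unfolding u_def[symmetric] by linarith
  have "exp (- (\<delta> * (of_int k + \<beta>)\<^sup>2)) \<le> exp (- (\<delta> * (2 * \<bar>of_int k\<bar> - (1 + 2 * \<bar>\<beta>\<bar>))))"
    using mult_left_mono[OF *, of \<delta>] assms by simp
  also have "\<dots> = ?C * exp (of_nat (nat \<bar>k\<bar>) * (- (2 * \<delta>)))"
    by (simp add: exp_add[symmetric] algebra_simps)
  also have "\<dots> = ?C * ?q ^ nat \<bar>k\<bar>" by (simp only: exp_of_nat_mult)
  finally show "exp (- (\<delta> * (of_int k + \<beta>)\<^sup>2)) \<le> ?C * ?q ^ nat \<bar>k\<bar>" .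
qed auto

section \<open>The double integral attached to one lattice point\<close>

text \<open>The contribution of a lattice point with coordinates \<open>p\<close> and
  \<open>r\<close> in the real parameters \<open>t\<close> and \<open>x\<close>, without its
  constant power of \<open>q\<close>. At \<open>x = 0\<close> the value is 0 by the convention for
  division by zero.\<close>

definition theta_kernel :: "real \<Rightarrow> real \<Rightarrow> real \<Rightarrow> real \<Rightarrow> real" where
  "theta_kernel p r t x = p * r * exp (- (pi * (p\<^sup>2 * t + r\<^sup>2 * t * x))) / sqrt x"

lemma theta_kernel_measurable [measurable]:
  "theta_kernel p r t \<in> borel_measurable borel"
  unfolding theta_kernel_def by measurable

lemma has_integral_inverse_sqrt: "((\<lambda>x. 1 / sqrt x) has_integral 2) {0..1::real}"
proof -
  have "((\<lambda>x. 1 / sqrt x) has_integral (2 * sqrt 1 - 2 * sqrt 0)) {0..1::real}"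
    by (rule fundamental_theorem_of_calculus_interior)
      (auto intro!: continuous_intros derivative_eq_intros
        simp flip: has_real_derivative_iff_has_vector_derivative simp: field_simps)
  then show ?thesis by simp
qed

text \<open>As a function of \<open>t\<close> the kernel is a pure exponential, whose rate
  \<open>k\<close> is positive because \<open>p > 0\<close>. At \<open>x = 0\<close> both sides are
  0, since they divide by \<open>sqrt 0\<close>.\<close>

lemma nn_integral_theta_kernel_t:
  assumes "p > 0" "r \<ge> 0" "x \<ge> 0"
  shows "(\<integral>\<^sup>+t. ennreal (theta_kernel p r t x) * indicator {0..} t \<partial>lborel)
    = ennreal (p * r / (pi * (p\<^sup>2 + r\<^sup>2 * x) * sqrt x))"
proof -
  define k C where "k = pi * (p\<^sup>2 + r\<^sup>2 * x)" and "C = p * r / sqrt x"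
  have k: "k > 0" unfolding k_def using assms by (intro mult_pos_pos add_pos_nonneg) auto
  have C: "C \<ge> 0" unfolding C_def using assms by simp
  have eq: "theta_kernel p r t x = C * exp (- (k * t))" for t
    by (simp add: theta_kernel_def k_def C_def algebra_simps)
  have "(\<integral>\<^sup>+t. ennreal (theta_kernel p r t x) * indicator {0..} t \<partial>lborel)
      = ennreal (0 - (- (C / k) * exp (- (k * 0))))"
    unfolding eq
  proof (rule nn_integral_FTC_atLeast)
    show "((\<lambda>t. - (C / k) * exp (- (k * t))) has_real_derivative C * exp (- (k * t))) (at t)" for t
      using k by (auto intro!: derivative_eq_intros)
    have "filterlim (\<lambda>t. k * t) at_top at_top"
      using k by (intro filterlim_tendsto_pos_mult_at_top[OF tendsto_const]) (auto simp: filterlim_ident)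
    then show "((\<lambda>t. - (C / k) * exp (- (k * t))) \<longlongrightarrow> 0) at_top"
      by (intro tendsto_mult_right_zero filterlim_compose[OF exp_at_bot]
        filterlim_compose[OF filterlim_uminus_at_bot_at_top])
  qed (use C in auto)
  then show ?thesis by (simp add: k_def C_def mult_ac)
qed

text \<open>The antiderivative \<open>2 / pi * arctan (r * sqrt x / p)\<close> is continuous on the
  closed interval but in general not differentiable at 0, hence the interior version of the
  fundamental theorem.\<close>

lemma has_integral_arctan_sqrt:
  assumes "p > 0" "r \<ge> 0"
  shows "((\<lambda>x. p * r / (pi * (p\<^sup>2 + r\<^sup>2 * x) * sqrt x)) has_integral (2 / pi * arctan (r / p))) {0..1::real}"
proof -
  have "((\<lambda>x. p * r / (pi * (p\<^sup>2 + r\<^sup>2 * x) * sqrt x)) has_integral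
    (2 / pi * arctan (r * sqrt 1 / p) - 2 / pi * arctan (r * sqrt 0 / p))) {0..1::real}"
  proof (rule fundamental_theorem_of_calculus_interior)
    show "continuous_on {0..1} (\<lambda>x. 2 / pi * arctan (r * sqrt x / p))"
      using assms by (intro continuous_intros) auto
    fix x :: real assume x: "x \<in> {0<..<1}"
    define k where "k = p\<^sup>2 + r\<^sup>2 * x"
    have k: "k > 0" unfolding k_def using x assms by (intro add_pos_nonneg) auto
    have "((\<lambda>x. 2 / pi * arctan (r * sqrt x / p)) has_real_derivative
        2 / pi * (inverse (1 + (r * sqrt x / p)\<^sup>2) * (r * (inverse (sqrt x) / 2) / p))) (at x)"
      by (rule DERIV_cmult DERIV_chain2[OF DERIV_arctan] DERIV_cdivide DERIV_real_sqrt refl | use x in simp)+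
    also have "1 + (r * sqrt x / p)\<^sup>2 = k / p\<^sup>2"
      using x assms by (simp add: k_def field_simps power_divide power_mult_distrib)
    also have "2 / pi * (inverse (k / p\<^sup>2) * (r * (inverse (sqrt x) / 2) / p)) = p * r / (pi * k * sqrt x)"
      using x assms k by (simp add: field_simps power2_eq_square)
    finally show "((\<lambda>x. 2 / pi * arctan (r * sqrt x / p)) has_vector_derivative
        p * r / (pi * (p\<^sup>2 + r\<^sup>2 * x) * sqrt x)) (at x)"
      unfolding has_real_derivative_iff_has_vector_derivative k_def .
  qed auto
  then show ?thesis by simp
qed

lemma has_sum_set_lebesgue_integral:
  fixes f :: "'i \<Rightarrow> 'a \<Rightarrow> 'b::{banach, second_countable_topology}"
  assumes "countable I"
    and int: "\<And>i. i \<in> I \<Longrightarrow> set_integrable M S (f i)"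
    and sm: "\<And>x. x \<in> S \<Longrightarrow> (\<lambda>i. norm (f i x)) summable_on I"
    and smi: "(\<lambda>i. LINT x:S|M. norm (f i x)) summable_on I"
  shows "set_integrable M S (\<lambda>x. \<Sum>\<^sub>\<infinity>i\<in>I. f i x)"
    and "((\<lambda>i. LINT x:S|M. f i x) has_sum (LINT x:S|M. (\<Sum>\<^sub>\<infinity>i\<in>I. f i x))) I"
proof -
  let ?f = "\<lambda>i x. indicator S x *\<^sub>R f i x"
  have eq: "(\<Sum>\<^sub>\<infinity>i\<in>I. ?f i x) = indicator S x *\<^sub>R (\<Sum>\<^sub>\<infinity>i\<in>I. f i x)" for x
    by (simp split: split_indicator)
  have 1: "integrable M (?f i)" if "i \<in> I" for i
    using int[OF that] by (simp add: set_integrable_def)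
  have 2: "(\<lambda>i. norm (?f i x)) summable_on I" for x
    using sm[of x] by (simp split: split_indicator)
  have 3: "(\<lambda>i. \<integral>x. norm (?f i x) \<partial>M) summable_on I"
    using smi by (simp add: set_lebesgue_integral_def)
  show "set_integrable M S (\<lambda>x. \<Sum>\<^sub>\<infinity>i\<in>I. f i x)"
    using has_sum_lebesgue_integral(1)[OF assms(1) 1 2 3] by (simp only: eq set_integrable_def)
  show "((\<lambda>i. LINT x:S|M. f i x) has_sum (LINT x:S|M. (\<Sum>\<^sub>\<infinity>i\<in>I. f i x))) I"
    using has_sum_lebesgue_integral(2)[OF assms(1) 1 2 3] by (simp only: eq set_lebesgue_integral_def)
qed

lemma set_integrable_inverse_sqrt:
  "set_integrable lborel {0..1} (\<lambda>x::real. 1 / sqrt x)" "(LINT x:{0..1}|lborel. 1 / sqrt x) = 2"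
proof -
  have "(\<integral>\<^sup>+x. ennreal (indicator {0..1} x * (1 / sqrt x)) \<partial>lborel) = ennreal 2"
    by (rule nn_integral_has_integral_lebesgue[OF _ has_integral_inverse_sqrt]) auto
  then have "has_bochner_integral lborel (\<lambda>x. indicator {0..1} x * (1 / sqrt x)) 2"
    by (intro has_bochner_integral_nn_integral) (auto simp: indicator_def)
  then show "set_integrable lborel {0..1} (\<lambda>x::real. 1 / sqrt x)" "(LINT x:{0..1}|lborel. 1 / sqrt x) = 2"
    by (auto simp: has_bochner_integral_iff set_integrable_def set_lebesgue_integral_def)
qed

lemma theta_kernel_sgn: "theta_kernel p r t x = sgn p * sgn r * theta_kernel \<bar>p\<bar> \<bar>r\<bar> t x"
proof -
  have "p * r = sgn p * sgn r * (\<bar>p\<bar> * \<bar>r\<bar>)" by (auto simp: sgn_if abs_if)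
  then show ?thesis by (simp add: theta_kernel_def)
qed

lemma abs_theta_kernel: "0 \<le> x \<Longrightarrow> \<bar>theta_kernel p r t x\<bar> = theta_kernel \<bar>p\<bar> \<bar>r\<bar> t x"
  by (simp add: theta_kernel_def abs_mult)

text \<open>Bounding the exponential by 1 gives a majorant uniform in \<open>t\<close> and
  integrable in \<open>x\<close> over the unit interval. It controls the inner integral, but being
  constant in \<open>t\<close> it cannot control the outer one.\<close>

lemma abs_theta_kernel_le:
  assumes "0 \<le> t" "0 \<le> x"
  shows "\<bar>theta_kernel p r t x\<bar> \<le> \<bar>p * r\<bar> * (1 / sqrt x)"
proof -
  have "exp (- (pi * (p\<^sup>2 * t + r\<^sup>2 * t * x))) \<le> 1" using assms by simp
  then have "\<bar>p * r\<bar> * exp (- (pi * (p\<^sup>2 * t + r\<^sup>2 * t * x))) / sqrt x \<le> \<bar>p * r\<bar> * 1 / sqrt x"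
    using assms by (intro divide_right_mono mult_left_mono) auto
  then show ?thesis using assms by (simp add: theta_kernel_def abs_mult)
qed

lemma set_integrable_theta_kernel:
  assumes "0 \<le> t"
  shows "set_integrable lborel {0..1} (theta_kernel p r t)"
proof (rule set_integrable_bound)
  show "set_integrable lborel {0..1} (\<lambda>x. \<bar>p * r\<bar> * (1 / sqrt x))"
    using set_integrable_inverse_sqrt(1) by (rule set_integrable_mult_right)
  show "set_borel_measurable lborel {0..1} (theta_kernel p r t)"
    unfolding set_borel_measurable_def by measurable
  show "AE x in lborel. x \<in> {0..1} \<longrightarrow> norm (theta_kernel p r t x) \<le> norm (\<bar>p * r\<bar> * (1 / sqrt x))"
    using abs_theta_kernel_le[OF assms] by (auto simp: abs_mult)
qed

text \<open>The kernel is nonnegative here, so Tonelli allows integrating first over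
  \<open>t\<close>, where closed forms exist. The finite value yields integrability on the product,
  and Fubini then restores the order of the statement.\<close>

lemma theta_kernel_double_integral_pos:
  assumes "p > 0" "r \<ge> 0"
  shows "set_integrable lborel {0..} (\<lambda>t. LINT x:{0..1}|lborel. theta_kernel p r t x)"
    and "(LINT t:{0..}|lborel. LINT x:{0..1}|lborel. theta_kernel p r t x) = 2 / pi * arctan (r / p)"
proof -
  define \<phi> where "\<phi> = (\<lambda>(t, x). indicator {0..} t * (indicator {0..1} x * theta_kernel p r t x))"
  have [measurable]: "\<phi> \<in> borel_measurable (lborel \<Otimes>\<^sub>M lborel)"
    unfolding \<phi>_def theta_kernel_def by measurable
  have nonneg: "0 \<le> \<phi> z" for z
    using assms by (auto simp: \<phi>_def theta_kernel_def indicator_def split: prod.splits)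
  have "(\<integral>\<^sup>+z. ennreal (\<phi> z) \<partial>(lborel \<Otimes>\<^sub>M lborel)) = (\<integral>\<^sup>+x. \<integral>\<^sup>+t. ennreal (\<phi> (t, x)) \<partial>lborel \<partial>lborel)"
    by (rule lborel_pair.nn_integral_snd[symmetric]) measurable
  also have "\<dots> = (\<integral>\<^sup>+x. ennreal (indicator {0..1} x * (p * r / (pi * (p\<^sup>2 + r\<^sup>2 * x) * sqrt x))) \<partial>lborel)"
  proof (intro nn_integral_cong)
    fix x :: real
    show "(\<integral>\<^sup>+t. ennreal (\<phi> (t, x)) \<partial>lborel) = ennreal (indicator {0..1} x * (p * r / (pi * (p\<^sup>2 + r\<^sup>2 * x) * sqrt x)))"
    proof (cases "x \<in> {0..1}")
      case True
      have "(\<integral>\<^sup>+t. ennreal (\<phi> (t, x)) \<partial>lborel)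
          = (\<integral>\<^sup>+t. ennreal (theta_kernel p r t x) * indicator {0..} t \<partial>lborel)"
        using True by (intro nn_integral_cong) (auto simp: \<phi>_def indicator_def)
      then show ?thesis using nn_integral_theta_kernel_t[OF assms, of x] True by simp
    qed (simp add: \<phi>_def)
  qed
  also have "\<dots> = ennreal (2 / pi * arctan (r / p))"
    by (rule nn_integral_has_integral_lebesgue[OF _ has_integral_arctan_sqrt[OF assms]])
      (use assms in \<open>auto intro!: divide_nonneg_nonneg mult_nonneg_nonneg add_nonneg_nonneg\<close>)
  finally have "has_bochner_integral (lborel \<Otimes>\<^sub>M lborel) \<phi> (2 / pi * arctan (r / p))"
    using nonneg assms by (intro has_bochner_integral_nn_integral) (auto simp: zero_le_arctan_iff)
  then have \<phi>: "integrable (lborel \<Otimes>\<^sub>M lborel) \<phi>" "integral\<^sup>L (lborel \<Otimes>\<^sub>M lborel) \<phi> = 2 / pi * arctan (r / p)"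
    by (auto simp: has_bochner_integral_iff)
  have eq: "(\<integral>x. \<phi> (t, x) \<partial>lborel) = indicator {0..} t *\<^sub>R (LINT x:{0..1}|lborel. theta_kernel p r t x)" for t
    by (simp add: \<phi>_def set_lebesgue_integral_def)
  show "set_integrable lborel {0..} (\<lambda>t. LINT x:{0..1}|lborel. theta_kernel p r t x)"
    using lborel_pair.integrable_fst'[OF \<phi>(1)] unfolding eq set_integrable_def .
  show "(LINT t:{0..}|lborel. LINT x:{0..1}|lborel. theta_kernel p r t x) = 2 / pi * arctan (r / p)"
    using lborel_pair.integral_fst'[OF \<phi>(1)] unfolding eq \<phi>(2) set_lebesgue_integral_def .
qed

text \<open>The kernel is odd in \<open>p\<close> and in \<open>r\<close>, and \<open>arctan\<close>
  is odd, so absolute values suffice. For \<open>p = 0\<close> the kernel vanishes, in agreement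
  with \<open>r / 0 = 0\<close>.\<close>

lemma theta_kernel_double_integral:
  shows "set_integrable lborel {0..} (\<lambda>t. LINT x:{0..1}|lborel. theta_kernel p r t x)"
    and "(LINT t:{0..}|lborel. LINT x:{0..1}|lborel. theta_kernel p r t x) = 2 / pi * arctan (r / p)"
proof -
  have eq: "(LINT x:{0..1}|lborel. theta_kernel p r t x)
      = sgn p * sgn r * (LINT x:{0..1}|lborel. theta_kernel \<bar>p\<bar> \<bar>r\<bar> t x)" for t
    by (subst theta_kernel_sgn) (rule set_integral_mult_right)
  have at: "sgn p * sgn r * arctan (\<bar>r\<bar> / \<bar>p\<bar>) = arctan (r / p)"
  proof -
    have "arctan z = sgn z * arctan \<bar>z\<bar>" for z :: real
      by (cases "z \<ge> 0") (auto simp: sgn_if arctan_minus)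
    moreover have "sgn p * sgn r = sgn (r / p)" by (auto simp: sgn_if zero_less_divide_iff)
    ultimately show ?thesis by (metis abs_divide)
  qed
  show "set_integrable lborel {0..} (\<lambda>t. LINT x:{0..1}|lborel. theta_kernel p r t x)"
  proof (cases "p = 0")
    case False
    then show ?thesis
      unfolding eq by (intro set_integrable_mult_right theta_kernel_double_integral_pos(1)) auto
  qed (simp add: theta_kernel_def set_integrable_def set_lebesgue_integral_def)
  show "(LINT t:{0..}|lborel. LINT x:{0..1}|lborel. theta_kernel p r t x) = 2 / pi * arctan (r / p)"
  proof (cases "p = 0")
    case False
    then show ?thesis
      unfolding eq set_integral_mult_right at[symmetric]
      by (subst theta_kernel_double_integral_pos(2)) auto
  qed (simp add: theta_kernel_def set_lebesgue_integral_def)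
qed

section \<open>Termwise integration of the theta series\<close>

text \<open>The sum passes through one integral at a time. For the inner integral the norms are
  dominated using \<open>prT\<close>. For the outer one a bound uniform in \<open>t\<close> is
  useless, and the exact double integral of the absolute kernel, at most 1, leaves the majorant
  \<open>norm (T n)\<close>.\<close>

lemma theta_series:
  fixes p r :: "'i \<Rightarrow> real" and T :: "'i \<Rightarrow> complex"
  assumes cI: "countable I"
    and T: "(\<lambda>n. norm (T n)) summable_on I"
    and prT: "(\<lambda>n. norm (T n) * \<bar>p n * r n\<bar>) summable_on I"
  defines "F \<equiv> \<lambda>t x. \<Sum>\<^sub>\<infinity>n\<in>I. T n * complex_of_real (theta_kernel (p n) (r n) t x)"
  shows "0 \<le> t \<Longrightarrow> set_integrable lborel {0..1} (F t)"
    and "set_integrable lborel {0..} (\<lambda>t. LINT x:{0..1}|lborel. F t x)"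
    and "((\<lambda>n. T n * complex_of_real (2 / pi * arctan (r n / p n))) has_sum
      (LINT t:{0..}|lborel. LINT x:{0..1}|lborel. F t x)) I"
proof -
  let ?g = "\<lambda>n t x. T n * complex_of_real (theta_kernel (p n) (r n) t x)"
  let ?G = "\<lambda>n t. LINT x:{0..1}|lborel. ?g n t x"
  have G: "?G n t = T n * complex_of_real (LINT x:{0..1}|lborel. theta_kernel (p n) (r n) t x)" for n t
    by (simp add: set_integral_complex_of_real)
  have intg: "set_integrable lborel {0..1} (?g n t)" if "0 \<le> t" for n t
    using set_integrable_theta_kernel[OF that, of "p n" "r n"]
    by (intro set_integrable_mult_right) (simp add: set_integrable_def of_real_mult[symmetric] scaleR_conv_of_real del: of_real_mult)
  have abs_eq: "(LINT x:{0..1}|lborel. \<bar>theta_kernel p r t x\<bar>) = (LINT x:{0..1}|lborel. theta_kernel \<bar>p\<bar> \<bar>r\<bar> t x)" for p r t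
    by (intro set_lebesgue_integral_cong) (auto simp: abs_theta_kernel)
  have norm_g: "(LINT x:{0..1}|lborel. norm (?g n t x))
      = norm (T n) * (LINT x:{0..1}|lborel. theta_kernel \<bar>p n\<bar> \<bar>r n\<bar> t x)" for n t
    by (simp add: norm_mult abs_eq)
  \<comment> \<open>The factor 2 is the integral of \<open>1 / sqrt x\<close> over the unit
    interval.\<close>
  have kle: "(LINT x:{0..1}|lborel. theta_kernel \<bar>p\<bar> \<bar>r\<bar> t x) \<le> \<bar>p * r\<bar> * 2" if "0 \<le> t" for p r t
  proof -
    have "(LINT x:{0..1}|lborel. theta_kernel \<bar>p\<bar> \<bar>r\<bar> t x) \<le> (LINT x:{0..1}|lborel. \<bar>p * r\<bar> * (1 / sqrt x))"
    proof (rule set_integral_mono)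
      show "set_integrable lborel {0..1} (\<lambda>x. \<bar>p * r\<bar> * (1 / sqrt x))"
        using set_integrable_inverse_sqrt(1) by (rule set_integrable_mult_right)
      show "theta_kernel \<bar>p\<bar> \<bar>r\<bar> t x \<le> \<bar>p * r\<bar> * (1 / sqrt x)" if "x \<in> {0..1}" for x
        using abs_theta_kernel_le[OF \<open>0 \<le> t\<close>, of x p r] that by (simp add: abs_theta_kernel)
    qed (rule set_integrable_theta_kernel[OF that])
    then show ?thesis by (simp only: set_integral_mult_right set_integrable_inverse_sqrt(2))
  qed
  have knonneg: "0 \<le> (LINT x:{0..1}|lborel. theta_kernel \<bar>p\<bar> \<bar>r\<bar> t x)" for p r t
    unfolding set_lebesgue_integral_def by (rule integral_nonneg_AE) (auto simp: indicator_def theta_kernel_def)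
  have inner: "set_integrable lborel {0..1} (F t)" "((\<lambda>n. ?G n t) has_sum (LINT x:{0..1}|lborel. F t x)) I"
    if t: "0 \<le> t" for t
  proof -
    have 2: "(\<lambda>n. norm (?g n t x)) summable_on I" if "x \<in> {0..1}" for x
    proof (rule summable_on_comparison_test)
      show "(\<lambda>n. norm (T n) * \<bar>p n * r n\<bar> * (1 / sqrt x)) summable_on I"
        by (rule summable_on_cmult_left[OF prT])
      show "norm (?g n t x) \<le> norm (T n) * \<bar>p n * r n\<bar> * (1 / sqrt x)" for n
        using mult_left_mono[OF abs_theta_kernel_le[OF t, of x "p n" "r n"], of "norm (T n)"] that
        by (simp add: norm_mult mult.assoc)
    qed auto
    have 3: "(\<lambda>n. LINT x:{0..1}|lborel. norm (?g n t x)) summable_on I"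
    proof (rule summable_on_comparison_test)
      show "(\<lambda>n. norm (T n) * \<bar>p n * r n\<bar> * 2) summable_on I"
        by (rule summable_on_cmult_left[OF prT])
      show "(LINT x:{0..1}|lborel. norm (?g n t x)) \<le> norm (T n) * \<bar>p n * r n\<bar> * 2" for n
        unfolding norm_g mult.assoc by (intro mult_left_mono kle t norm_ge_zero)
    qed (unfold norm_g, intro mult_nonneg_nonneg knonneg norm_ge_zero)
    show "set_integrable lborel {0..1} (F t)" "((\<lambda>n. ?G n t) has_sum (LINT x:{0..1}|lborel. F t x)) I"
      unfolding F_def
      using has_sum_set_lebesgue_integral[where S = "{0..1}" and f = "\<lambda>n. ?g n t", OF cI intg[OF t] 2 3] by blast+
  qed
  show "0 \<le> t \<Longrightarrow> set_integrable lborel {0..1} (F t)" by (rule inner(1))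
  have nG: "norm (?G n t) \<le> norm (T n) * (LINT x:{0..1}|lborel. theta_kernel \<bar>p n\<bar> \<bar>r n\<bar> t x)" for n t
    using integral_norm_bound[of lborel "\<lambda>x. indicator {0..1} x *\<^sub>R ?g n t x"]
    unfolding norm_g[symmetric]
    by (simp only: set_lebesgue_integral_def norm_scaleR abs_indicator real_scaleR_def)
  have intG: "set_integrable lborel {0..} (?G n)" for n
    unfolding G using theta_kernel_double_integral(1)[of "p n" "r n"]
    by (intro set_integrable_mult_right) (simp add: set_integrable_def of_real_mult[symmetric] scaleR_conv_of_real del: of_real_mult)
  have 2: "(\<lambda>n. norm (?G n t)) summable_on I" if "t \<in> {0..}" for t
  proof (rule summable_on_comparison_test)
    show "(\<lambda>n. norm (T n) * \<bar>p n * r n\<bar> * 2) summable_on I"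
      by (rule summable_on_cmult_left[OF prT])
    have "norm (T n) * (LINT x:{0..1}|lborel. theta_kernel \<bar>p n\<bar> \<bar>r n\<bar> t x) \<le> norm (T n) * (\<bar>p n * r n\<bar> * 2)" for n
      using that by (intro mult_left_mono kle) auto
    then show "norm (?G n t) \<le> norm (T n) * \<bar>p n * r n\<bar> * 2" for n
      unfolding mult.assoc[of _ _ 2] by (rule order_trans[OF nG])
  qed auto
  have 3: "(\<lambda>n. LINT t:{0..}|lborel. norm (?G n t)) summable_on I"
  proof (rule summable_on_comparison_test[OF T])
    fix n
    have "(LINT t:{0..}|lborel. norm (?G n t))
        \<le> (LINT t:{0..}|lborel. norm (T n) * (LINT x:{0..1}|lborel. theta_kernel \<bar>p n\<bar> \<bar>r n\<bar> t x))"
      by (rule set_integral_mono[OF set_integrable_norm[OF intG]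
        set_integrable_mult_right[OF theta_kernel_double_integral(1)] nG])
    also have "\<dots> = norm (T n) * (2 / pi * arctan (\<bar>r n\<bar> / \<bar>p n\<bar>))"
      by (simp only: set_integral_mult_right theta_kernel_double_integral(2))
    \<comment> \<open>Boundedness of \<open>arctan\<close> makes the estimate independent of
      \<open>p n\<close> and \<open>r n\<close>.\<close>
    also have "\<dots> \<le> norm (T n) * (2 / pi * (pi / 2))"
      by (intro mult_left_mono less_imp_le[OF arctan_ubound]) auto
    finally show "(LINT t:{0..}|lborel. norm (?G n t)) \<le> norm (T n)" by simp
    show "0 \<le> (LINT t:{0..}|lborel. norm (?G n t))"
      unfolding set_lebesgue_integral_def by (rule integral_nonneg_AE) (auto simp: indicator_def)
  qed
  have outer: "set_integrable lborel {0..} (\<lambda>t. \<Sum>\<^sub>\<infinity>n\<in>I. ?G n t)"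
    "((\<lambda>n. LINT t:{0..}|lborel. ?G n t) has_sum (LINT t:{0..}|lborel. (\<Sum>\<^sub>\<infinity>n\<in>I. ?G n t))) I"
    using has_sum_set_lebesgue_integral[where S = "{0..}" and f = ?G, OF cI intG 2 3] by blast+
  have eq: "(\<Sum>\<^sub>\<infinity>n\<in>I. ?G n t) = (LINT x:{0..1}|lborel. F t x)" if "t \<in> {0..}" for t
    using inner(2)[of t] that by (intro infsumI) auto
  show "set_integrable lborel {0..} (\<lambda>t. LINT x:{0..1}|lborel. F t x)"
    using outer(1) by (subst (asm) set_integrable_cong[OF refl refl eq]) auto
  have "(LINT t:{0..}|lborel. (\<Sum>\<^sub>\<infinity>n\<in>I. ?G n t)) = (LINT t:{0..}|lborel. LINT x:{0..1}|lborel. F t x)"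
    using eq by (intro set_lebesgue_integral_cong) auto
  moreover have "(LINT t:{0..}|lborel. ?G n t) = T n * complex_of_real (2 / pi * arctan (r n / p n))" for n
    unfolding G by (simp only: set_integral_mult_right set_integral_complex_of_real theta_kernel_double_integral(2))
  ultimately show "((\<lambda>n. T n * complex_of_real (2 / pi * arctan (r n / p n))) has_sum
      (LINT t:{0..}|lborel. LINT x:{0..1}|lborel. F t x)) I"
    using outer(2) by simp
qed

section \<open>Summability over the shifted lattice\<close>

lemma shifted_lattice_eq_Times:
  "shifted_lattice \<alpha> = range (\<lambda>k::int. of_int k + fst \<alpha>) \<times> range (\<lambda>k::int. of_int k + snd \<alpha>)"
  unfolding shifted_lattice_def by auto

lemma countable_shifted_lattice: "countable (shifted_lattice \<alpha>)"
  unfolding shifted_lattice_eq_Times by (intro countable_SIGMA countable_image countableI_type)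

lemma zero_in_shifted_lattice_iff: "(0, 0) \<in> shifted_lattice \<alpha> \<longleftrightarrow> fst \<alpha> \<in> \<int> \<and> snd \<alpha> \<in> \<int>"
proof -
  have *: "0 \<in> range (\<lambda>k::int. of_int k + \<beta>) \<longleftrightarrow> \<beta> \<in> \<int>" for \<beta> :: real
  proof
    assume "0 \<in> range (\<lambda>k::int. of_int k + \<beta>)"
    then obtain k :: int where "\<beta> = of_int (- k)" by (auto simp: eq_neg_iff_add_eq_0 add.commute)
    then show "\<beta> \<in> \<int>" by (simp only: Ints_of_int)
  next
    assume "\<beta> \<in> \<int>"
    then obtain k :: int where "\<beta> = of_int k" by (elim Ints_cases)
    then show "0 \<in> range (\<lambda>k::int. of_int k + \<beta>)" by (intro image_eqI[of _ _ "- k"]) auto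
  qed
  show ?thesis unfolding shifted_lattice_eq_Times by (simp only: mem_Times_iff fst_conv snd_conv *)
qed

text \<open>Both the Gaussian and the lattice are products, so the double sum reduces to two sums
  over shifted integers.\<close>

lemma summable_on_gaussian_shifted_lattice:
  assumes "\<delta> > 0"
  shows "(\<lambda>n. exp (- (\<delta> * ((fst n)\<^sup>2 + (snd n)\<^sup>2)))) summable_on shifted_lattice \<alpha>"
proof -
  define g :: "real \<Rightarrow> real" where "g = (\<lambda>x. exp (- (\<delta> * x\<^sup>2)))"
  have g: "g summable_on range (\<lambda>k::int. of_int k + \<beta>)" for \<beta>
    by (subst summable_on_reindex) (use summable_on_gaussian[OF assms, of \<beta>] in \<open>auto simp: o_def g_def inj_on_def\<close>)
  have "(\<lambda>n. g (fst n) * g (snd n)) summable_on shifted_lattice \<alpha>"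
    unfolding shifted_lattice_eq_Times
  proof (rule summable_on_SigmaI)
    show "((\<lambda>y. g (fst (x, y)) * g (snd (x, y))) has_sum
        g x * infsum g (range (\<lambda>k::int. of_int k + snd \<alpha>))) (range (\<lambda>k::int. of_int k + snd \<alpha>))" for x
      using has_sum_cmult_right[OF has_sum_infsum[OF g]] by simp
    show "(\<lambda>x. g x * infsum g (range (\<lambda>k::int. of_int k + snd \<alpha>))) summable_on range (\<lambda>k::int. of_int k + fst \<alpha>)"
      by (rule summable_on_cmult_left[OF g])
  qed (simp add: g_def)
  then show ?thesis by (simp add: g_def exp_add[symmetric] algebra_simps)
qed

text \<open>For the symmetric matrix M with rows (a, b) and (b, c), Cayley-Hamilton expresses the
  squared norm of M v as the trace times v . M v minus the determinant times the squared norm of v.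
  That this is nonnegative is the claim.\<close>

lemma quad_form_ge:
  assumes "a > 0" "c > 0"
  shows "Discr a b c / (2 * (a + c)) * ((fst n)\<^sup>2 + (snd n)\<^sup>2) \<le> quad_form a b c n"
proof -
  obtain x y where n: "n = (x, y)" by force
  define A B C where "A = real_of_int a" and "B = real_of_int b" and "C = real_of_int c"
  have "0 \<le> (A * x + B * y)\<^sup>2 + (B * x + C * y)\<^sup>2" by simp
  also have "\<dots> = (A + C) * (A * x\<^sup>2 + 2 * B * x * y + C * y\<^sup>2) - (A * C - B\<^sup>2) * (x\<^sup>2 + y\<^sup>2)"
    by (simp add: algebra_simps power2_eq_square)
  finally have "(A * C - B\<^sup>2) * (x\<^sup>2 + y\<^sup>2) \<le> (A + C) * (A * x\<^sup>2 + 2 * B * x * y + C * y\<^sup>2)" by simp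
  moreover have "A + C > 0" using assms by (simp add: A_def C_def)
  ultimately have "(A * C - B\<^sup>2) / (2 * (A + C)) * (x\<^sup>2 + y\<^sup>2) \<le> (A * x\<^sup>2 + 2 * B * x * y + C * y\<^sup>2) / 2"
    by (simp add: field_simps)
  then show ?thesis by (simp add: n quad_form_def Discr_def A_def B_def C_def)
qed

lemma summable_on_exp_quad_form:
  assumes "a > 0" "c > 0" "Discr a b c > 0" "k > 0"
  shows "(\<lambda>n. exp (- (k * quad_form a b c n))) summable_on shifted_lattice \<alpha>"
proof (rule summable_on_comparison_test)
  let ?e = "Discr a b c / (2 * (a + c))"
  show "(\<lambda>n. exp (- (k * ?e * ((fst n)\<^sup>2 + (snd n)\<^sup>2)))) summable_on shifted_lattice \<alpha>"
    using assms by (intro summable_on_gaussian_shifted_lattice mult_pos_pos divide_pos_pos) auto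
  show "exp (- (k * quad_form a b c n)) \<le> exp (- (k * ?e * ((fst n)\<^sup>2 + (snd n)\<^sup>2)))" for n
    using mult_left_mono[OF quad_form_ge[OF assms(1,2), of b n], of k] assms(4) by (simp add: mult.assoc)
qed simp

lemma norm_q_power: "norm (q_power \<tau> s) = exp (- (2 * (pi * Im \<tau>) * s))"
  by (simp add: q_power_def mult_ac)

section \<open>Completing the square\<close>

text \<open>The square roots absorb the coefficients: the form becomes half the sum of the squares
  of \<open>theta_coord1\<close> and \<open>theta_coord2\<close>, and these squares multiply
  \<open>w\<^sub>1\<close> and \<open>w\<^sub>2\<close> in the exponent of
  \<open>Theta1_term\<close>.\<close>

definition theta_coord1 :: "int \<Rightarrow> int \<Rightarrow> int \<Rightarrow> real \<times> real \<Rightarrow> real" where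
  "theta_coord1 a b c n = sqrt (Discr a b c / c) * fst n"

definition theta_coord2 :: "int \<Rightarrow> int \<Rightarrow> int \<Rightarrow> real \<times> real \<Rightarrow> real" where
  "theta_coord2 a b c n = sqrt c * (snd n + b / c * fst n)"

context
  fixes a b c :: int
  assumes c: "c > 0" and D: "Discr a b c > 0"
begin

lemma theta_coord_square:
  "(theta_coord1 a b c n)\<^sup>2 = Discr a b c / c * (fst n)\<^sup>2"
  "(theta_coord2 a b c n)\<^sup>2 = c * (snd n + b / c * fst n)\<^sup>2"
  using c D by (auto simp: theta_coord1_def theta_coord2_def power_mult_distrib)

lemma theta_coord_mult:
  "theta_coord1 a b c n * theta_coord2 a b c n = sqrt (Discr a b c) * (fst n * (snd n + b / c * fst n))"
  using c D by (simp add: theta_coord1_def theta_coord2_def real_sqrt_divide)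

text \<open>This quotient is the argument of the arctangent. For \<open>fst n = 0\<close> both sides
  are 0, so no case distinction is required.\<close>

lemma theta_coord_divide:
  fixes n :: "real \<times> real"
  shows "theta_coord2 a b c n / theta_coord1 a b c n = (c * snd n + b * fst n) / (sqrt (Discr a b c) * fst n)"
proof -
  have "sqrt c * sqrt c = c" "sqrt c > 0" using c by auto
  then have "theta_coord2 a b c n / theta_coord1 a b c n
      = (sqrt c * sqrt c) * (snd n + b / c * fst n) / (sqrt (Discr a b c) * fst n)"
    by (simp only: theta_coord1_def theta_coord2_def real_sqrt_divide) (simp add: field_simps)
  then show ?thesis using c by (simp add: distrib_left)
qed

lemma quad_form_eq_theta_coord:
  "quad_form a b c n = ((theta_coord1 a b c n)\<^sup>2 + (theta_coord2 a b c n)\<^sup>2) / 2"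
  unfolding theta_coord_square using c
  by (cases n) (simp add: quad_form_def Discr_def field_simps power2_eq_square)

text \<open>Half of the exponential pays for the polynomial factor: the product of the coordinates
  is at most \<open>Q\<close> in absolute value, and
  \<open>Q \<le> 1 / k * exp (k * Q)\<close>.\<close>

lemma abs_theta_coord_mult_le:
  assumes "k > 0"
  shows "\<bar>theta_coord1 a b c n * theta_coord2 a b c n\<bar> * exp (- (2 * k * quad_form a b c n))
    \<le> 1 / k * exp (- (k * quad_form a b c n))"
proof -
  define Q where "Q = quad_form a b c n"
  have "0 \<le> (\<bar>theta_coord1 a b c n\<bar> - \<bar>theta_coord2 a b c n\<bar>)\<^sup>2" by simp
  then have "\<bar>theta_coord1 a b c n * theta_coord2 a b c n\<bar> \<le> Q"
    unfolding Q_def quad_form_eq_theta_coord power2_diff by (simp add: abs_mult)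
  also have "Q \<le> 1 / k * exp (k * Q)"
    using order_trans[OF _ exp_ge_add_one_self[of "k * Q"], of "k * Q"] assms
    by (simp add: pos_le_divide_eq mult.commute)
  finally have "\<bar>theta_coord1 a b c n * theta_coord2 a b c n\<bar> * exp (- (2 * k * Q))
      \<le> 1 / k * exp (k * Q) * exp (- (2 * k * Q))"
    by (rule mult_right_mono) simp
  also have "\<dots> = 1 / k * exp (- (k * Q))"
    by (simp add: exp_add[symmetric])
  finally show ?thesis by (simp only: Q_def)
qed

text \<open>The root of the discriminant in front of the double integral of the theorem is what
  turns the coefficient of \<open>Theta1_term\<close> into the product of the two
  coordinates.\<close>

lemma Theta1_term_eq:
  "sqrt (Discr a b c) * Theta1_term a b c (w1, w2) n
    = complex_of_real (theta_coord1 a b c n * theta_coord2 a b c n) *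
      exp (pi * \<i> * complex_of_real ((theta_coord1 a b c n)\<^sup>2) * w1 +
           pi * \<i> * complex_of_real ((theta_coord2 a b c n)\<^sup>2) * w2)"
  unfolding theta_coord_mult theta_coord_square by (cases n) (simp add: Theta1_term_def)

text \<open>On the vertical path the exponent splits into a multiple of \<tau>, which reassembles
  the quadratic form, and a real part, which is the exponent of the kernel. At \<open>x = 0\<close>
  both sides are 0.\<close>

lemma Theta1_term_eq_theta_kernel:
  "sqrt (Discr a b c) * Theta1_term a b c (\<tau> + \<i> * t, \<tau> + \<i> * (t * x)) n / sqrt x
    = q_power \<tau> (quad_form a b c n) *
      complex_of_real (theta_kernel (theta_coord1 a b c n) (theta_coord2 a b c n) t x)"
proof -
  define p r where "p = theta_coord1 a b c n" and "r = theta_coord2 a b c n"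
  have "pi * \<i> * complex_of_real (p\<^sup>2) * (\<tau> + \<i> * t) + pi * \<i> * complex_of_real (r\<^sup>2) * (\<tau> + \<i> * (t * x))
      = 2 * pi * \<i> * \<tau> * complex_of_real ((p\<^sup>2 + r\<^sup>2) / 2) + complex_of_real (- (pi * (p\<^sup>2 * t + r\<^sup>2 * t * x)))"
    by (simp add: field_simps)
  then have "exp (pi * \<i> * complex_of_real (p\<^sup>2) * (\<tau> + \<i> * t) + pi * \<i> * complex_of_real (r\<^sup>2) * (\<tau> + \<i> * (t * x)))
      = q_power \<tau> ((p\<^sup>2 + r\<^sup>2) / 2) * complex_of_real (exp (- (pi * (p\<^sup>2 * t + r\<^sup>2 * t * x))))"
    by (simp only: exp_add q_power_def exp_of_real)
  then show ?thesis
    unfolding Theta1_term_eq quad_form_eq_theta_coord p_def[symmetric] r_def[symmetric]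
    by (simp add: theta_kernel_def)
qed

text \<open>Lowering both imaginary parts to their minimum \<open>y\<close> recovers the quadratic
  form in the exponent, and \<open>abs_theta_coord_mult_le\<close> applies with
  \<open>k = pi * y\<close>.\<close>

lemma abs_summable_on_Theta1_term:
  assumes "a > 0" "Im w1 > 0" "Im w2 > 0"
  shows "(\<lambda>n. norm (Theta1_term a b c (w1, w2) n)) summable_on shifted_lattice \<alpha>"
proof (rule Infinite_Sum.abs_summable_on_comparison_test')
  define y where "y = min (Im w1) (Im w2)"
  have y: "y > 0" "y \<le> Im w1" "y \<le> Im w2" using assms by (auto simp: y_def)
  let ?C = "1 / sqrt (Discr a b c) * (1 / (pi * y))"
  show "(\<lambda>n. ?C * exp (- (pi * y * quad_form a b c n))) summable_on shifted_lattice \<alpha>"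
    using assms c D y by (intro summable_on_cmult_right summable_on_exp_quad_form) auto
  fix n
  define p r where "p = theta_coord1 a b c n" and "r = theta_coord2 a b c n"
  have "p\<^sup>2 * y \<le> p\<^sup>2 * Im w1" "r\<^sup>2 * y \<le> r\<^sup>2 * Im w2" using y by (intro mult_left_mono; simp)+
  then have "pi * (p\<^sup>2 * y + r\<^sup>2 * y) \<le> pi * (p\<^sup>2 * Im w1 + r\<^sup>2 * Im w2)"
    by (rule mult_left_mono[OF add_mono]) simp
  then have "exp (- (pi * (p\<^sup>2 * Im w1 + r\<^sup>2 * Im w2))) \<le> exp (- (2 * (pi * y) * ((p\<^sup>2 + r\<^sup>2) / 2)))"
    by (simp add: algebra_simps)
  then have "\<bar>p * r\<bar> * exp (- (pi * (p\<^sup>2 * Im w1 + r\<^sup>2 * Im w2))) \<le> \<bar>p * r\<bar> * exp (- (2 * (pi * y) * ((p\<^sup>2 + r\<^sup>2) / 2)))"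
    by (intro mult_left_mono) auto
  also have "\<dots> \<le> 1 / (pi * y) * exp (- (pi * y * quad_form a b c n))"
    using abs_theta_coord_mult_le[of "pi * y" n] y
    by (simp only: p_def r_def quad_form_eq_theta_coord[symmetric]) simp
  finally have "norm (sqrt (Discr a b c) * Theta1_term a b c (w1, w2) n)
      \<le> 1 / (pi * y) * exp (- (pi * y * quad_form a b c n))"
    unfolding Theta1_term_eq p_def[symmetric] r_def[symmetric]
    by (simp add: norm_mult abs_mult algebra_simps)
  then have "1 / sqrt (Discr a b c) * norm (sqrt (Discr a b c) * Theta1_term a b c (w1, w2) n)
      \<le> 1 / sqrt (Discr a b c) * (1 / (pi * y) * exp (- (pi * y * quad_form a b c n)))"
    by (rule mult_left_mono) (use D in simp)
  then show "norm (Theta1_term a b c (w1, w2) n) \<le> ?C * exp (- (pi * y * quad_form a b c n))"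
    using D by (simp add: norm_mult)
qed

end

section \<open>Symmetry under exchange of the coordinates\<close>

lemma quad_form_swap: "quad_form c b a (prod.swap n) = quad_form a b c n"
  by (cases n) (simp add: quad_form_def algebra_simps)

lemma Discr_swap: "Discr c b a = Discr a b c"
  by (simp add: Discr_def mult.commute)

text \<open>This transfers the results on \<open>Theta1_term\<close> to \<open>Theta2_term\<close>:
  their positivity assumptions hold for the form with \<open>a\<close> and \<open>c\<close>
  exchanged as well.\<close>

lemma Theta2_term_eq_Theta1_term: "Theta2_term a b c w n = Theta1_term c b a w (prod.swap n)"
  by (cases n; cases w) (simp add: Theta1_term_def Theta2_term_def Discr_swap[of c b a])

lemma shifted_lattice_swap: "prod.swap ` shifted_lattice \<alpha> = shifted_lattice (prod.swap \<alpha>)"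
  unfolding shifted_lattice_eq_Times by (auto simp: image_iff)

text \<open>The series are integrated in the Lebesgue sense, whereas contour and vertical integrals
  are of Henstock-Kurzweil type.\<close>

lemma has_integral_set_lebesgue_integral:
  fixes f :: "'a::euclidean_space \<Rightarrow> 'b::euclidean_space"
  assumes "set_integrable lborel S f"
  shows "(f has_integral (LINT x:S|lborel. f x)) S"
  using set_borel_integral_eq_integral[OF assms] by (metis integrable_integral)

lemma has_sum_diff:
  fixes f g :: "'i \<Rightarrow> 'a::{topological_ab_group_add, t2_space}"
  assumes "(f has_sum u) I" "(g has_sum v) I"
  shows "((\<lambda>i. f i - g i) has_sum (u - v)) I"
  using has_sum_add[OF assms(1), of "\<lambda>i. - g i" "- v"] assms(2) by (simp add: has_sum_uminus)

text \<open>Off the axes this is \<open>arctan_sum_eq\<close>. With exactly one zero coordinate, one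
  quotient is 0 by convention and the other is \<open>b / sqrt (Discr a b c)\<close>, which cancels
  \<open>A\<close>; at the origin both quotients are 0 and \<open>- A\<close> remains.\<close>

lemma arctan_theta_coord_sum:
  fixes a b c :: int and n :: "real \<times> real"
  assumes "a > 0" "c > 0" and D: "Discr a b c > 0"
  defines "A \<equiv> arctan (b / sqrt (Discr a b c))"
  shows "arctan (theta_coord2 a b c n / theta_coord1 a b c n)
      + arctan (theta_coord2 c b a (prod.swap n) / theta_coord1 c b a (prod.swap n)) - A
    = pi / 2 * (sgn (fst n) * sgn (snd n)) - (if n = 0 then A else 0)"
proof -
  obtain x y where n: "n = (x, y)" by force
  have eq: "theta_coord2 a b c n / theta_coord1 a b c n = (c * y + b * x) / (sqrt (Discr a b c) * x)"
    "theta_coord2 c b a (prod.swap n) / theta_coord1 c b a (prod.swap n)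
      = (a * x + b * y) / (sqrt (Discr a b c) * y)"
    using assms by (simp_all add: theta_coord_divide Discr_swap[of c b a] n)
  show ?thesis
  proof (cases "x = 0 \<or> y = 0")
    case True
    then show ?thesis unfolding eq using assms(1,2) by (auto simp: n A_def zero_prod_def)
  next
    case False
    have "(sqrt (Discr a b c))\<^sup>2 = real_of_int (Discr a b c)" using D by simp
    also have "\<dots> = a * c - (real_of_int b)\<^sup>2" by (simp add: Discr_def)
    finally show ?thesis
      unfolding eq using arctan_sum_eq[of "sqrt (Discr a b c)" a c b x y] False assms(1-3)
      by (simp add: n A_def zero_prod_def)
  qed
qed

section \<open>Evaluation of the iterated integral and comparison of the lattice sums\<close>

theorem proposition3p2:
  fixes a b c :: int and \<alpha> :: "real \<times> real" and \<tau> :: complex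
  assumes "pos_def_form a b c"
    and "fst \<alpha> \<in> \<rat>" and "snd \<alpha> \<in> \<rat>"
    and "Discr a b c > 0"
    and "Im \<tau> > 0"
  shows
    "(false_theta_term a b c \<tau> summable_on shifted_lattice \<alpha>) \<and>
     (Theta_term a b c \<tau> summable_on shifted_lattice \<alpha>) \<and>
     (\<forall>w\<^sub>1 w\<^sub>2. Im w\<^sub>1 > 0 \<and> Im w\<^sub>2 > 0 \<longrightarrow>
             Theta1_term a b c (w\<^sub>1, w\<^sub>2) summable_on shifted_lattice \<alpha> \<and>
             Theta2_term a b c (w\<^sub>1, w\<^sub>2) summable_on shifted_lattice \<alpha>) \<and>
     (\<forall>t::real. t > 0 \<longrightarrow>
             theta_integrand a b c \<alpha> \<tau> (\<tau> + \<i> * t) contour_integrable_on linepath \<tau> (\<tau> + \<i> * t)) \<and>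
     (vertically_integrable
             (\<lambda>w\<^sub>1. contour_integral (linepath \<tau> w\<^sub>1) (\<lambda>w\<^sub>2. theta_integrand a b c \<alpha> \<tau> w\<^sub>1 w\<^sub>2)) \<tau>) \<and>
     (false_theta a b c \<alpha> \<tau>
             - 2 / pi * of_bool (fst \<alpha> \<in> \<int> \<and> snd \<alpha> \<in> \<int>) * arctan (b / sqrt (Discr a b c))
           = sqrt (Discr a b c) *
               vertical_integral \<tau>
                 (\<lambda>w\<^sub>1. contour_integral (linepath \<tau> w\<^sub>1) (\<lambda>w\<^sub>2. theta_integrand a b c \<alpha> \<tau> w\<^sub>1 w\<^sub>2))
             - 2 / pi * arctan (b / sqrt (Discr a b c)) * Theta a b c \<alpha> \<tau>)"
proof -
  note D = assms(4)
  have D': "Discr c b a > 0" using D by (simp add: Discr_swap)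
  have a: "a > 0" and c: "c > 0"
    using assms(1)[unfolded pos_def_form_def, rule_format, of "(1, 0)"]
      assms(1)[unfolded pos_def_form_def, rule_format, of "(0, 1)"]
    by (auto simp: quad_form_def zero_prod_def)
  define L where "L = shifted_lattice \<alpha>"
  define d where "d = complex_of_real (sqrt (Discr a b c))"
  have d: "d \<noteq> 0" using D by (simp add: d_def)
  define T where "T = (\<lambda>n. q_power \<tau> (quad_form a b c n))"
  \<comment> \<open>The primed coordinates belong to the exchanged form. Composing them with the
    swap lets both series run over the same \<open>L\<close> with the same coefficients
    \<open>T\<close>.\<close>
  define p r p' r' where "p = theta_coord1 a b c" and "r = theta_coord2 a b c"
    and "p' = (\<lambda>n. theta_coord1 c b a (prod.swap n))" and "r' = (\<lambda>n. theta_coord2 c b a (prod.swap n))"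
  define v where "v = pi * Im \<tau>"
  have v: "v > 0" using assms(5) by (simp add: v_def)
  have L: "countable L" unfolding L_def by (rule countable_shifted_lattice)
  have normT: "norm (T n) = exp (- (2 * v * quad_form a b c n))" for n
    by (simp add: T_def norm_q_power v_def)
  have sumT: "(\<lambda>n. norm (T n)) summable_on L"
    unfolding normT L_def using v by (intro summable_on_exp_quad_form a c D) simp
  have sum_exp: "(\<lambda>n. 1 / v * exp (- (v * quad_form a b c n))) summable_on L"
    unfolding L_def by (intro summable_on_cmult_right summable_on_exp_quad_form a c D v)
  have sumprT: "(\<lambda>n. norm (T n) * \<bar>p n * r n\<bar>) summable_on L"
    by (rule summable_on_comparison_test[OF sum_exp])
      (use abs_theta_coord_mult_le[OF c D v] in \<open>auto simp: normT p_def r_def mult.commute\<close>)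
  have sumprT': "(\<lambda>n. norm (T n) * \<bar>p' n * r' n\<bar>) summable_on L"
    by (rule summable_on_comparison_test[OF sum_exp])
      (use abs_theta_coord_mult_le[OF a D' v, of "prod.swap n" for n] in
        \<open>auto simp: normT p'_def r'_def mult.commute quad_form_swap\<close>)
  define F where "F = (\<lambda>t x. \<Sum>\<^sub>\<infinity>n\<in>L. T n * complex_of_real (theta_kernel (p n) (r n) t x))"
  define F' where "F' = (\<lambda>t x. \<Sum>\<^sub>\<infinity>n\<in>L. T n * complex_of_real (theta_kernel (p' n) (r' n) t x))"
  define H where "H = (\<lambda>t. LINT x:{0..1}|lborel. F t x)"
  define H' where "H' = (\<lambda>t. LINT x:{0..1}|lborel. F' t x)"
  define V where "V = (LINT t:{0..}|lborel. H t)"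
  define V' where "V' = (LINT t:{0..}|lborel. H' t)"
  have F_eq: "(\<Sum>\<^sub>\<infinity>n\<in>L. T n * complex_of_real (theta_kernel (p n) (r n) t x)) = F t x"
    and F'_eq: "(\<Sum>\<^sub>\<infinity>n\<in>L. T n * complex_of_real (theta_kernel (p' n) (r' n) t x)) = F' t x"
    and H_eq: "(LINT x:{0..1}|lborel. F t x) = H t" and H'_eq: "(LINT x:{0..1}|lborel. F' t x) = H' t" for t x
    by (simp_all add: F_def F'_def H_def H'_def)
  note S = theta_series[OF L sumT sumprT, unfolded F_eq, unfolded H_eq, folded V_def]
  note S' = theta_series[OF L sumT sumprT', unfolded F'_eq, unfolded H'_eq, folded V'_def]

  have F: "F t x = d * Theta1 a b c \<alpha> (\<tau> + \<i> * t, \<tau> + \<i> * (t * x)) / sqrt x" for t x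
  proof -
    have "F t x = (\<Sum>\<^sub>\<infinity>n\<in>L. (d / sqrt x) * Theta1_term a b c (\<tau> + \<i> * t, \<tau> + \<i> * (t * x)) n)"
      unfolding F_def T_def p_def r_def Theta1_term_eq_theta_kernel[OF c D, symmetric] by (simp add: d_def)
    then show ?thesis unfolding infsum_cmult_right' by (simp add: Theta1_def L_def)
  qed
  have F': "F' t x = d * Theta2 a b c \<alpha> (\<tau> + \<i> * t, \<tau> + \<i> * (t * x)) / sqrt x" for t x
  proof -
    have "T n * complex_of_real (theta_kernel (p' n) (r' n) t x)
        = (d / sqrt x) * Theta2_term a b c (\<tau> + \<i> * t, \<tau> + \<i> * (t * x)) n" for n
      unfolding T_def p'_def r'_def
      using Theta1_term_eq_theta_kernel[OF a D', of \<tau> t x "prod.swap n"]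
      by (simp add: quad_form_swap Theta2_term_eq_Theta1_term d_def Discr_swap[of c b a])
    then have "F' t x = (\<Sum>\<^sub>\<infinity>n\<in>L. (d / sqrt x) * Theta2_term a b c (\<tau> + \<i> * t, \<tau> + \<i> * (t * x)) n)"
      unfolding F'_def by simp
    then show ?thesis unfolding infsum_cmult_right' by (simp add: Theta2_def L_def)
  qed
  \<comment> \<open>The last factor on the left is the derivative of the line path. Against the
    product \<open>- (t * sqrt x)\<close> of the two roots it leaves
    \<open>- \<i> / sqrt x\<close>.\<close>
  have integrand: "theta_integrand a b c \<alpha> \<tau> (\<tau> + \<i> * t) (linepath \<tau> (\<tau> + \<i> * t) x) * (\<tau> + \<i> * t - \<tau>)
      = - \<i> / d * (F t x + F' t x)" if "t > 0" "x \<in> {0..1}" for t x :: real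
  proof -
    have lp: "linepath \<tau> (\<tau> + \<i> * t) x = \<tau> + \<i> * (t * x)"
      by (simp add: linepath_def scaleR_conv_of_real algebra_simps)
    \<comment> \<open>The argument is \<open>- s\<close>, on the branch cut, where the principal
      root is \<open>\<i> * sqrt s\<close>.\<close>
    have sq: "csqrt (\<i> * (\<i> * s)) = \<i> * sqrt s" if "s \<ge> 0" for s :: real
    proof -
      have "\<i> * (\<i> * s) = complex_of_real (- s)" by (simp add: mult.assoc[symmetric])
      then show ?thesis using that by (simp only: csqrt_of_real_nonpos) simp
    qed
    have "csqrt (\<i> * (\<tau> + \<i> * t - \<tau>)) * csqrt (\<i> * (\<tau> + \<i> * (t * x) - \<tau>))
        = - (complex_of_real t * complex_of_real (sqrt x))"
    proof -
      have "csqrt (\<i> * (\<tau> + \<i> * t - \<tau>)) = \<i> * sqrt t" using sq[of t] that by simp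
      moreover have "csqrt (\<i> * (\<tau> + \<i> * (t * x) - \<tau>)) = \<i> * (sqrt t * sqrt x)"
        using sq[of "t * x"] that by (simp add: real_sqrt_mult)
      moreover have "complex_of_real (sqrt t) * sqrt t = t"
        using that by (simp flip: of_real_mult)
      ultimately show ?thesis by (simp add: algebra_simps)
    qed
    \<comment> \<open>Here \<open>z\<close> stands for \<open>sqrt x\<close>; for
      \<open>z = 0\<close>, the starting point of the path, both sides are 0.\<close>
    moreover have "(u + u') / - (t * z) * (\<tau> + \<i> * t - \<tau>) = - \<i> / d * (d * u / z + d * u' / z)"
      for u u' z :: complex
      using d \<open>t > 0\<close> by (cases "z = 0") (simp_all add: field_simps)
    ultimately show ?thesis
      unfolding lp theta_integrand_def F F' by simp
  qed
  have contour: "(theta_integrand a b c \<alpha> \<tau> (\<tau> + \<i> * t) has_contour_integral - \<i> / d * (H t + H' t))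
      (linepath \<tau> (\<tau> + \<i> * t))" if "t > 0" for t :: real
  proof -
    have "((\<lambda>x. - \<i> / d * (F t x + F' t x)) has_integral - \<i> / d * (H t + H' t)) {0..1}"
      unfolding H_def H'_def using that
      by (intro has_integral_mult_right has_integral_add has_integral_set_lebesgue_integral S(1) S'(1)) auto
    then show ?thesis
      unfolding has_contour_integral_linepath
      by (rule has_integral_eq[rotated]) (rule integrand[OF that, symmetric])
  qed
  let ?I = "\<lambda>w\<^sub>1. contour_integral (linepath \<tau> w\<^sub>1) (\<lambda>w\<^sub>2. theta_integrand a b c \<alpha> \<tau> w\<^sub>1 w\<^sub>2)"
  have "((\<lambda>t. 1 / d * (H t + H' t)) has_integral 1 / d * (V + V')) {0..}"
    unfolding V_def V'_def
    by (intro has_integral_mult_right has_integral_add has_integral_set_lebesgue_integral S(2) S'(2))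
  then have vert: "((\<lambda>t::real. ?I (\<tau> + \<i> * t) * \<i>) has_integral 1 / d * (V + V')) {0..}"
  \<comment> \<open>\<open>contour\<close> covers only \<open>t > 0\<close>, and the single point 0
    does not affect the integral. The factor \<i> from the parametrization of the outer path cancels
    the \<open>- \<i>\<close> of the inner integral.\<close>
  proof (rule has_integral_spike[of "{0}", rotated 2])
    fix t :: real assume "t \<in> {0..} - {0}"
    then have "?I (\<tau> + \<i> * t) = - \<i> / d * (H t + H' t)"
      by (intro contour_integral_unique contour) auto
    moreover have "- \<i> / d * u * \<i> = 1 / d * u" for u by (simp add: mult_ac)
    ultimately show "?I (\<tau> + \<i> * t) * \<i> = 1 / d * (H t + H' t)" by (simp only:)
  qed simp
  define A where "A = arctan (b / sqrt (Discr a b c))"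
  have Theta: "(T has_sum Theta a b c \<alpha> \<tau>) L"
    using has_sum_infsum[OF abs_summable_summable[OF sumT]]
    by (simp add: Theta_def Theta_term_def[abs_def] T_def L_def)
  have sum_false: "false_theta_term a b c \<tau> summable_on L"
  proof (rule abs_summable_summable, rule summable_on_comparison_test[OF sumT])
    show "norm (false_theta_term a b c \<tau> n) \<le> norm (T n)" for n
      by (auto simp: false_theta_term_def T_def norm_mult sgn_if)
  qed auto
  have term_eq: "T n * (2 / pi * arctan (r n / p n)) + T n * (2 / pi * arctan (r' n / p' n)) - 2 / pi * A * T n
      = false_theta_term a b c \<tau> n - (if n = 0 then 2 / pi * A else 0)" for n
  proof -
    have "2 / pi * arctan (r n / p n) + 2 / pi * arctan (r' n / p' n) - 2 / pi * A
        = 2 / pi * (arctan (r n / p n) + arctan (r' n / p' n) - A)"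
      by (simp add: algebra_simps)
    also have "\<dots> = sgn (fst n) * sgn (snd n) - (if n = 0 then 2 / pi * A else 0)"
      unfolding p_def r_def p'_def r'_def A_def arctan_theta_coord_sum[OF a c D] by (simp add: right_diff_distrib)
    finally have "T n * complex_of_real (2 / pi * arctan (r n / p n) + 2 / pi * arctan (r' n / p' n) - 2 / pi * A)
        = T n * complex_of_real (sgn (fst n) * sgn (snd n) - (if n = 0 then 2 / pi * A else 0))"
      by simp
    \<comment> \<open>At the origin the power of \<open>q\<close> is 1, so the exceptional term is a
      constant independent of \<tau>.\<close>
    moreover have "n = 0 \<Longrightarrow> T n = 1" by (simp add: T_def q_power_def quad_form_def zero_prod_def)
    ultimately show ?thesis
      by (simp add: T_def false_theta_term_def algebra_simps split: if_splits)
  qed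
  have lhs: "((\<lambda>n. T n * (2 / pi * arctan (r n / p n)) + T n * (2 / pi * arctan (r' n / p' n)) - 2 / pi * A * T n)
      has_sum V + V' - 2 / pi * A * Theta a b c \<alpha> \<tau>) L"
    using S(3) S'(3) Theta
    by (intro has_sum_diff has_sum_add has_sum_cmult_right) (simp_all add: of_real_mult)
  \<comment> \<open>The correction is supported at the origin, so its sum tests whether the lattice
    contains 0, that is, whether both shifts are integers.\<close>
  have delta: "((\<lambda>n. complex_of_real (if n = 0 then 2 / pi * A else 0)) has_sum
      2 / pi * of_bool (fst \<alpha> \<in> \<int> \<and> snd \<alpha> \<in> \<int>) * A) L"
    by (rule has_sum_finite_neutralI[of "L \<inter> {0}"])
      (auto simp: zero_in_shifted_lattice_iff[symmetric] zero_prod_def L_def)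
  have "(false_theta_term a b c \<tau> has_sum false_theta a b c \<alpha> \<tau>) L"
    using has_sum_infsum[OF sum_false] by (simp add: false_theta_def L_def)
  note rhs = has_sum_diff[OF this delta]
  \<comment> \<open>By \<open>term_eq\<close> the families in \<open>lhs\<close> and
    \<open>rhs\<close> coincide, so their sums agree.\<close>
  have main: "false_theta a b c \<alpha> \<tau> - 2 / pi * of_bool (fst \<alpha> \<in> \<int> \<and> snd \<alpha> \<in> \<int>) * A
      = V + V' - 2 / pi * A * Theta a b c \<alpha> \<tau>"
    using lhs rhs unfolding term_eq by (rule has_sum_unique[rotated])
  show ?thesis
  proof (intro conjI allI impI)
    show "false_theta_term a b c \<tau> summable_on shifted_lattice \<alpha>"
      using sum_false by (simp add: L_def)
    show "Theta_term a b c \<tau> summable_on shifted_lattice \<alpha>"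
      using abs_summable_summable[OF sumT] by (simp add: Theta_term_def[abs_def] T_def L_def)
    fix w\<^sub>1 w\<^sub>2 :: complex assume w: "Im w\<^sub>1 > 0 \<and> Im w\<^sub>2 > 0"
    show "Theta1_term a b c (w\<^sub>1, w\<^sub>2) summable_on shifted_lattice \<alpha>"
      using w by (intro abs_summable_summable[OF abs_summable_on_Theta1_term[OF c D a]]) auto
    \<comment> \<open>The swap maps the lattice onto the one with swapped shift, so summability
      there pulls back to \<open>Theta2_term\<close> by reindexing.\<close>
    have "(\<lambda>n. Theta1_term c b a (w\<^sub>1, w\<^sub>2) n) summable_on prod.swap ` shifted_lattice \<alpha>"
      unfolding shifted_lattice_swap using w
      by (intro abs_summable_summable[OF abs_summable_on_Theta1_term[OF a D' c]]) auto
    then show "Theta2_term a b c (w\<^sub>1, w\<^sub>2) summable_on shifted_lattice \<alpha>"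
      by (subst (asm) summable_on_reindex) (simp_all add: o_def Theta2_term_eq_Theta1_term[abs_def])
  next
    show "theta_integrand a b c \<alpha> \<tau> (\<tau> + \<i> * t) contour_integrable_on linepath \<tau> (\<tau> + \<i> * t)"
      if "t > 0" for t :: real
      using contour[OF that] by (rule has_contour_integral_integrable)
    show "vertically_integrable ?I \<tau>"
      unfolding vertically_integrable_def using vert by (rule has_integral_integrable)
    have "d * vertical_integral \<tau> ?I = V + V'"
      unfolding vertical_integral_def integral_unique[OF vert] using d by simp
    then show "false_theta a b c \<alpha> \<tau>
             - 2 / pi * of_bool (fst \<alpha> \<in> \<int> \<and> snd \<alpha> \<in> \<int>) * arctan (b / sqrt (Discr a b c))
           = sqrt (Discr a b c) * vertical_integral \<tau> ?I
             - 2 / pi * arctan (b / sqrt (Discr a b c)) * Theta a b c \<alpha> \<tau>"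
      using main by (simp add: d_def A_def)
  qed
qed

end
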